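(* Let $n\ge 2$, let $s,y\in\mathbb{R}^n$ satisfy $s^\top y>0$, let $t,\nu\ge 0$, and set $$\mathcal T=tI+\nu\,yy^\top,\qquad \mathcal P=I-\frac{sy^\top}{s^\top y}+\mathcal T\frac{ss^\top}{s^\top y}.$$ Then the singular values of $\mathcal P$ (counted with multiplicity) are $1$ with multiplicity $n-2$ together with the two numbers $$\sigma^\pm=\frac{\|s\|}{2(s^\top y)}\Big(\|\mathcal T s+y\|\pm\|\mathcal T s-y\|\Big),$$ which satisfy $$\sigma^-\sigma^+=\frac{\|s\|^2}{s^\top y}\cdot\frac{s^\top\mathcal T y}{s^\top y},\qquad (\sigma^-)^2+(\sigma^+)^2=\frac{\|\mathcal T s\|^2\|s\|^2}{(s^\top y)^2}+\frac{\|s\|^2\|y\|^2}{(s^\top y)^2}.$$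
   Context: $\|\cdot\|$ is the Euclidean norm and $I$ the $n\times n$ identity. Here $s=x_{k+1}-x_k$ and $y=\nabla f(x_{k+1})-\nabla f(x_k)$ are the step and gradient displacement of an iteration with a Wolfe line search, which guarantees $s^\top y>0$. $\mathcal P$ is the search direction matrix of the Matrix Dai--Liao method. The statement allows that $\sigma^-$ or $\sigma^+$ may also equal $1$. *)

theory Defs
  imports "Jordan_Normal_Form.Char_Poly"
begin

definition euclid_norm :: "real vec \<Rightarrow> real" where
  "euclid_norm v = sqrt (v \<bullet> v)"

definition outer_prod :: "real vec \<Rightarrow> real vec \<Rightarrow> real mat" where
  "outer_prod v w = mat (dim_vec v) (dim_vec w) (\<lambda>(i, j). v $ i * w $ j)"

(* Singular values of a real square matrix: the nonnegative square roots of the eigenvalues of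
   A^T A, with algebraic multiplicity. As A^T A is symmetric positive semidefinite, its
   characteristic polynomial splits over the reals, so no eigenvalue is lost by taking only the
   real roots, and for n x n matrices the multiset has n elements. *)
definition singular_values :: "real mat \<Rightarrow> real multiset" where
  "singular_values A = image_mset sqrt (proots (char_poly (transpose_mat A * A)))"

definition MDL_scaling_matrix :: "nat \<Rightarrow> real \<Rightarrow> real \<Rightarrow> real vec \<Rightarrow> real mat" where
  "MDL_scaling_matrix n t \<nu> y = t \<cdot>\<^sub>m 1\<^sub>m n + \<nu> \<cdot>\<^sub>m outer_prod y y"

definition MDL_search_direction_matrix ::
  "nat \<Rightarrow> real mat \<Rightarrow> real vec \<Rightarrow> real vec \<Rightarrow> real mat" where
  "MDL_search_direction_matrix n T s y =
     1\<^sub>m n - (1 / (s \<bullet> y)) \<cdot>\<^sub>m outer_prod s y + T * ((1 / (s \<bullet> y)) \<cdot>\<^sub>m outer_prod s s)"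

end

theory Submission
  imports Defs
begin

text \<open>Write \<open>w = T s\<close>, which lies in the span of \<open>s\<close> and \<open>y\<close>. Expanding
  \<open>P\<^sup>T P\<close> shows that it is \<open>I + U V\<close> with \<open>U\<close> of size \<open>n \<times> 2\<close>, so Sylvester's determinant
  identity reduces its characteristic polynomial to that of the \<open>2 \<times> 2\<close> matrix \<open>I + V U\<close>, times
  \<open>(x - 1)\<^bsup>n-2\<^esup>\<close>. The trace and determinant of \<open>I + V U\<close> are the sum and the product of the
  squares of the two claimed singular values; these are nonnegative because \<open>w \<bullet> y \<ge> 0\<close>.\<close>

text \<open>Evaluate the determinant of the block matrix \<open>M\<close> in two ways. Multiplying
  by \<open>R\<close> on the right clears the block \<open>V\<close> and leaves
  \<open>c I - U V\<close>; multiplying by \<open>L\<close> on the left clears it as well and leaves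
  \<open>c I - V U\<close>.\<close>

lemma sylvester_det_identity:
  fixes U V :: "'a :: idom mat"
  assumes U: "U \<in> carrier_mat n m" and V: "V \<in> carrier_mat m n"
  shows "c ^ m * det (c \<cdot>\<^sub>m 1\<^sub>m n - U * V) = c ^ n * det (c \<cdot>\<^sub>m 1\<^sub>m m - V * U)"
proof -
  define M where "M = four_block_mat (c \<cdot>\<^sub>m 1\<^sub>m n) U V (1\<^sub>m m)"
  \<comment> \<open>The block \<open>c I\<close> lets \<open>- V * (c I)\<close> cancel against
    \<open>(c I) * V\<close>. It costs the factor \<open>c ^ m\<close> but avoids dividing by
    \<open>c\<close>, which is a polynomial in the application.\<close>
  define L where "L = four_block_mat (1\<^sub>m n) (0\<^sub>m n m) (- V) (c \<cdot>\<^sub>m 1\<^sub>m m)"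
  define R where "R = four_block_mat (1\<^sub>m n) (0\<^sub>m n m) (- V) (1\<^sub>m m)"
  have carr: "M \<in> carrier_mat (n + m) (n + m)" "L \<in> carrier_mat (n + m) (n + m)"
    "R \<in> carrier_mat (n + m) (n + m)"
    by (auto simp: M_def L_def R_def)
  have UV: "U * V \<in> carrier_mat n n" and VU: "V * U \<in> carrier_mat m m"
    using U V by auto
  have "M * R = four_block_mat (c \<cdot>\<^sub>m 1\<^sub>m n - U * V) U (0\<^sub>m m n) (1\<^sub>m m)"
    unfolding M_def R_def
    by (subst mult_four_block_mat[of _ n n _ m _ m _ _ n _ m])
      (use U V UV in \<open>auto intro!: cong_four_block_mat\<close>)
  moreover have "det R = 1"
    unfolding R_def using V by (subst det_four_block_mat_upper_right_zero[of _ n _ m]) auto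
  moreover have "det (four_block_mat (c \<cdot>\<^sub>m 1\<^sub>m n - U * V) U (0\<^sub>m m n) (1\<^sub>m m))
      = det (c \<cdot>\<^sub>m 1\<^sub>m n - U * V)"
    using det_four_block_mat_lower_left_zero[OF minus_carrier_mat[OF UV] U refl one_carrier_mat]
    by simp
  ultimately have detM: "det M = det (c \<cdot>\<^sub>m 1\<^sub>m n - U * V)"
    using det_mult[of M "n + m" R] carr by simp
  have "L * M = four_block_mat (c \<cdot>\<^sub>m 1\<^sub>m n) U (0\<^sub>m m n) (c \<cdot>\<^sub>m 1\<^sub>m m - V * U)"
    unfolding M_def L_def
    by (subst mult_four_block_mat[of _ n n _ m _ m _ _ n _ m])
      (use U V VU in \<open>auto intro!: cong_four_block_mat\<close>)
  moreover have "det L = c ^ m"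
    unfolding L_def using V by (subst det_four_block_mat_upper_right_zero[of _ n _ m]) auto
  moreover have "det (four_block_mat (c \<cdot>\<^sub>m 1\<^sub>m n) U (0\<^sub>m m n) (c \<cdot>\<^sub>m 1\<^sub>m m - V * U))
      = c ^ n * det (c \<cdot>\<^sub>m 1\<^sub>m m - V * U)"
    using det_four_block_mat_lower_left_zero[OF smult_carrier_mat[OF one_carrier_mat] U refl
      minus_carrier_mat[OF VU]] by simp
  ultimately show ?thesis
    using detM det_mult[of L "n + m" M] carr by simp
qed

text \<open>Since \<open>X I - (I + U V) = (X - 1) I - U V\<close>, this is Sylvester's identity
  over the polynomial ring with \<open>c = X - 1\<close>; \<open>?h\<close> embeds the entries as
  constant polynomials.\<close>

lemma char_poly_one_add_mult:
  fixes U V :: "'a :: idom mat"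
  assumes U: "U \<in> carrier_mat n m" and V: "V \<in> carrier_mat m n"
  shows "[:-1, 1:] ^ m * char_poly (1\<^sub>m n + U * V) = [:-1, 1:] ^ n * char_poly (1\<^sub>m m + V * U)"
proof -
  let ?h = "map_mat (\<lambda>a :: 'a. [:a:])"
  have *: "char_poly (1\<^sub>m k + A * B) = det ([:-1, 1:] \<cdot>\<^sub>m 1\<^sub>m k - ?h A * ?h B)"
    if "A \<in> carrier_mat k l" "B \<in> carrier_mat l k" for A B :: "'a mat" and k l
  proof -
    have AB: "A * B \<in> carrier_mat k k" using that by auto
    have "char_poly_matrix (1\<^sub>m k + A * B) = [:-1, 1:] \<cdot>\<^sub>m 1\<^sub>m k - ?h A * ?h B"
      unfolding map_poly_mult(1)[OF that, symmetric]
      using that AB by (intro eq_matI) (auto simp: char_poly_matrix_def one_pCons)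
    then show ?thesis by (simp add: char_poly_def)
  qed
  show ?thesis
    unfolding *[OF U V] *[OF V U]
    by (rule sylvester_det_identity) (use U V in auto)
qed

lemma MDL_scaling_matrix_mult_vec:
  assumes v: "v \<in> carrier_vec n" and y: "y \<in> carrier_vec n"
  shows "MDL_scaling_matrix n t \<nu> y *\<^sub>v v = t \<cdot>\<^sub>v v + (\<nu> * (y \<bullet> v)) \<cdot>\<^sub>v y"
proof (rule eq_vecI)
  fix i assume "i < dim_vec (t \<cdot>\<^sub>v v + (\<nu> * (y \<bullet> v)) \<cdot>\<^sub>v y)"
  then have i: "i < n" using y by simp
  have "(MDL_scaling_matrix n t \<nu> y *\<^sub>v v) $ i
      = (\<Sum>k = 0..<n. (t * of_bool (i = k) + \<nu> * (y $ i * y $ k)) * v $ k)"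
    using i v y by (auto simp: scalar_prod_def MDL_scaling_matrix_def outer_prod_def intro!: sum.cong)
  also have "\<dots> = (\<Sum>k = 0..<n. (if k = i then t * v $ k else 0))
      + \<nu> * y $ i * (\<Sum>k = 0..<n. y $ k * v $ k)"
    unfolding sum_distrib_left sum.distrib[symmetric]
    by (intro sum.cong) (auto simp: algebra_simps)
  also have "\<dots> = (t \<cdot>\<^sub>v v + (\<nu> * (y \<bullet> v)) \<cdot>\<^sub>v y) $ i"
    using i v y by (simp add: scalar_prod_def)
  finally show "(MDL_scaling_matrix n t \<nu> y *\<^sub>v v) $ i
      = (t \<cdot>\<^sub>v v + (\<nu> * (y \<bullet> v)) \<cdot>\<^sub>v y) $ i" .
qed (use v y in \<open>simp add: MDL_scaling_matrix_def outer_prod_def\<close>)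

text \<open>Because \<open>w\<close> is a combination of \<open>s\<close> and \<open>y\<close>, the
  perturbation of the identity is a symmetric form in these two vectors. Its coefficient matrix
  \<open>K\<close> has entries \<open>k11\<close>, \<open>k12\<close>, \<open>k12\<close>,
  \<open>k22\<close>; \<open>U\<close> has columns \<open>s\<close> and \<open>y\<close>, and
  \<open>V\<close> is \<open>K\<close> times the transpose of \<open>U\<close>.\<close>

lemma transpose_mult_MDL_search_direction_matrix:
  fixes s y :: "real vec" and t \<nu> :: real
  assumes s: "s \<in> carrier_vec n" and y: "y \<in> carrier_vec n" and sy: "s \<bullet> y \<noteq> 0"
  defines "T \<equiv> MDL_scaling_matrix n t \<nu> y"
  defines "P \<equiv> MDL_search_direction_matrix n T s y"
    and "w \<equiv> t \<cdot>\<^sub>v s + (\<nu> * (s \<bullet> y)) \<cdot>\<^sub>v y"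
  defines "k11 \<equiv> 2 * t / (s \<bullet> y) + (w \<bullet> w) / (s \<bullet> y)\<^sup>2"
    and "k12 \<equiv> - 1 / (s \<bullet> y) - t * (s \<bullet> s) / (s \<bullet> y)\<^sup>2"
    and "k22 \<equiv> (s \<bullet> s) / (s \<bullet> y)\<^sup>2"
  defines "U \<equiv> mat_of_cols n [s, y]"
    and "V \<equiv> mat_of_rows n [k11 \<cdot>\<^sub>v s + k12 \<cdot>\<^sub>v y, k12 \<cdot>\<^sub>v s + k22 \<cdot>\<^sub>v y]"
  shows "T *\<^sub>v s = w" and "transpose_mat P * P = 1\<^sub>m n + U * V"
proof -
  let ?b = "s \<bullet> y"
  have T: "T \<in> carrier_mat n n"
    using y by (simp add: T_def MDL_scaling_matrix_def outer_prod_def)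
  have w: "w \<in> carrier_vec n" using s y by (simp add: w_def)
  show Ts: "T *\<^sub>v s = w"
    using s y by (simp add: T_def w_def MDL_scaling_matrix_mult_vec comm_scalar_prod[of y n s])
  have P: "P \<in> carrier_mat n n"
    using s y T by (simp add: P_def MDL_search_direction_matrix_def outer_prod_def)
  \<comment> \<open>As \<open>T (s s^T) = (T s) s^T\<close>, the matrix \<open>P\<close> is the
    identity plus \<open>(w s^T - s y^T) / (s \<bullet> y)\<close>.\<close>
  have Pij: "P $$ (i, j) = of_bool (i = j) + s $ i * (- y $ j / ?b) + w $ i * (s $ j / ?b)"
    if "i < n" "j < n" for i j
  proof -
    have "(T * ((1 / ?b) \<cdot>\<^sub>m outer_prod s s)) $$ (i, j) = (T *\<^sub>v s) $ i * (s $ j / ?b)"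
      using that s T by (simp add: outer_prod_def scalar_prod_def sum_distrib_right sum_divide_distrib mult.assoc)
    then show ?thesis
      using that s y T unfolding Ts
      by (cases "i = j") (simp_all add: P_def MDL_search_direction_matrix_def outer_prod_def)
  qed
  show "transpose_mat P * P = 1\<^sub>m n + U * V"
  proof (rule eq_matI)
    fix i j assume "i < dim_row (1\<^sub>m n + U * V)" "j < dim_col (1\<^sub>m n + U * V)"
    then have i: "i < n" and j: "j < n" by (auto simp: U_def V_def)
    \<comment> \<open>Column \<open>j\<close> of \<open>P\<close> is the unit vector
      \<open>e_j\<close> plus \<open>\<alpha> j\<close> times \<open>s\<close> plus
      \<open>\<beta> j\<close> times \<open>w\<close>.\<close>
    define \<alpha> \<beta> where "\<alpha> = (\<lambda>i. - y $ i / ?b)" and "\<beta> = (\<lambda>i. s $ i / ?b)"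
    have w_idx: "w $ k = t * s $ k + \<nu> * ?b * y $ k" if "k < n" for k
      using that s y by (simp add: w_def)
    have sw: "s \<bullet> w = t * (s \<bullet> s) + \<nu> * ?b\<^sup>2"
      using s y by (simp add: w_def scalar_prod_add_distrib[of _ n] power2_eq_square)
    have "(transpose_mat P * P) $$ (i, j) = (\<Sum>k = 0..<n. P $$ (k, i) * P $$ (k, j))"
      using i j P by (simp add: scalar_prod_def)
    also have "\<dots> = (\<Sum>k = 0..<n. (of_bool (k = i) + s $ k * \<alpha> i + w $ k * \<beta> i) * (of_bool (k = j) + s $ k * \<alpha> j + w $ k * \<beta> j))"
      using i j by (intro sum.cong) (auto simp: Pij \<alpha>_def \<beta>_def)
    \<comment> \<open>The product of the two Kronecker deltas is counted in the first sum only, so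
      the second sum omits it.\<close>
    also have "\<dots> = (\<Sum>k = 0..<n. if k = i then of_bool (i = j) + s $ k * \<alpha> j + w $ k * \<beta> j else 0)
       + (\<Sum>k = 0..<n. if k = j then s $ k * \<alpha> i + w $ k * \<beta> i else 0)
       + (\<Sum>k = 0..<n. s $ k * s $ k) * (\<alpha> i * \<alpha> j) + (\<Sum>k = 0..<n. s $ k * w $ k) * (\<alpha> i * \<beta> j + \<beta> i * \<alpha> j)
       + (\<Sum>k = 0..<n. w $ k * w $ k) * (\<beta> i * \<beta> j)"
      unfolding sum_distrib_right sum.distrib[symmetric]
      by (intro sum.cong) (auto simp: algebra_simps)
    also have "\<dots> = of_bool (i = j) + s $ i * \<alpha> j + w $ i * \<beta> j + s $ j * \<alpha> i + w $ j * \<beta> i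
       + (s \<bullet> s) * (\<alpha> i * \<alpha> j) + (s \<bullet> w) * (\<alpha> i * \<beta> j + \<beta> i * \<alpha> j) + (w \<bullet> w) * (\<beta> i * \<beta> j)"
      using i j s w by (simp add: scalar_prod_def)
    \<comment> \<open>In the mixed coefficient, the \<open>\<nu>\<close> from the linear terms in
      \<open>w\<close> cancels the one from \<open>s \<bullet> w\<close>; hence \<open>k12\<close>
      is free of \<open>\<nu>\<close>.\<close>
    also have "\<dots> = of_bool (i = j) + (s $ i * (k11 * s $ j + k12 * y $ j) + y $ i * (k12 * s $ j + k22 * y $ j))"
      unfolding sw w_idx[OF i] w_idx[OF j] using sy
      by (simp add: \<alpha>_def \<beta>_def k11_def k12_def k22_def field_simps power2_eq_square)
    also have "\<dots> = (1\<^sub>m n + U * V) $$ (i, j)"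
      using i j s y by (simp add: U_def V_def scalar_prod_def mat_of_cols_def mat_of_rows_def)
    finally show "(transpose_mat P * P) $$ (i, j) = (1\<^sub>m n + U * V) $$ (i, j)" .
  qed (use P in \<open>auto simp: U_def V_def\<close>)
qed

lemma det_mat_2:
  fixes A :: "'a :: comm_ring_1 mat"
  assumes A: "A \<in> carrier_mat 2 2"
  shows "det A = A $$ (0, 0) * A $$ (1, 1) - A $$ (0, 1) * A $$ (1, 0)"
proof -
  have "{..<2} = {0, 1 :: nat}" by auto
  moreover have "det (mat_delete A i 0) = mat_delete A i 0 $$ (0, 0)" for i
    using A by (intro det_single) (auto simp: mat_delete_def)
  ultimately show ?thesis
    using A by (subst laplace_expansion_column[OF A, of 0])
      (auto simp: cofactor_def mat_delete_def algebra_simps)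
qed

lemma char_poly_mat_2:
  fixes A :: "'a :: comm_ring_1 mat"
  assumes A: "A \<in> carrier_mat 2 2"
  shows "char_poly A = [:A $$ (0, 0) * A $$ (1, 1) - A $$ (0, 1) * A $$ (1, 0),
    - (A $$ (0, 0) + A $$ (1, 1)), 1:]"
  unfolding char_poly_def
  by (subst det_mat_2) (use A in \<open>auto simp: char_poly_matrix_def algebra_simps\<close>)

theorem mainTheorem5:
  fixes n :: nat and s y :: "real vec" and t \<nu> \<sigma>\<^sub>m \<sigma>\<^sub>p :: real and T P :: "real mat"
  assumes "n \<ge> 2"
    and "s \<in> carrier_vec n" and "y \<in> carrier_vec n"
    and "s \<bullet> y > 0"
    and "t \<ge> 0" and "\<nu> \<ge> 0"
    and "T = MDL_scaling_matrix n t \<nu> y"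
    and "P = MDL_search_direction_matrix n T s y"
    and "\<sigma>\<^sub>m = euclid_norm s / (2 * (s \<bullet> y)) *
           (euclid_norm (T *\<^sub>v s + y) - euclid_norm (T *\<^sub>v s - y))"
    and "\<sigma>\<^sub>p = euclid_norm s / (2 * (s \<bullet> y)) *
           (euclid_norm (T *\<^sub>v s + y) + euclid_norm (T *\<^sub>v s - y))"
  shows "singular_values P = replicate_mset (n - 2) 1 + {#\<sigma>\<^sub>m, \<sigma>\<^sub>p#}
    \<and> \<sigma>\<^sub>m * \<sigma>\<^sub>p =
        (euclid_norm s)\<^sup>2 / (s \<bullet> y) * ((s \<bullet> (T *\<^sub>v y)) / (s \<bullet> y))
    \<and> \<sigma>\<^sub>m\<^sup>2 + \<sigma>\<^sub>p\<^sup>2 =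
        (euclid_norm (T *\<^sub>v s))\<^sup>2 * (euclid_norm s)\<^sup>2 / (s \<bullet> y)\<^sup>2
        + (euclid_norm s)\<^sup>2 * (euclid_norm y)\<^sup>2 / (s \<bullet> y)\<^sup>2"
proof -
  define b S Y w W where "b = s \<bullet> y" and "S = s \<bullet> s" and "Y = y \<bullet> y"
    and "w = T *\<^sub>v s" and "W = w \<bullet> w"
  define k11 k12 k22 where "k11 = 2 * t / b + W / b\<^sup>2"
    and "k12 = - 1 / b - t * S / b\<^sup>2" and "k22 = S / b\<^sup>2"
  define U where "U = mat_of_cols n [s, y]"
  define V where "V = mat_of_rows n [k11 \<cdot>\<^sub>v s + k12 \<cdot>\<^sub>v y, k12 \<cdot>\<^sub>v s + k22 \<cdot>\<^sub>v y]"
  note s = assms(2) and y = assms(3)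
  have b: "b > 0" using assms(4) by (simp add: b_def)
  have ys: "y \<bullet> s = b" using s y by (simp add: b_def comm_scalar_prod)
  have UV: "U \<in> carrier_mat n 2" "V \<in> carrier_mat 2 n" by (auto simp: U_def V_def)
  note MDL = transpose_mult_MDL_search_direction_matrix[OF s y, of t \<nu>, folded assms(7), folded assms(8)]
  have w_eq: "w = t \<cdot>\<^sub>v s + (\<nu> * b) \<cdot>\<^sub>v y"
    using MDL(1) b by (simp add: w_def b_def)
  then have w: "w \<in> carrier_vec n" using s y by simp
  have PP: "transpose_mat P * P = 1\<^sub>m n + U * V"
    using MDL(2) b
    unfolding U_def V_def k11_def k12_def k22_def W_def w_eq unfolding b_def S_def by simp
  have wy: "w \<bullet> y = t * b + \<nu> * b * Y"
    using s y by (simp add: w_eq add_scalar_prod_distrib[of _ n] b_def Y_def)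
  have sw: "s \<bullet> w = t * S + \<nu> * b\<^sup>2"
    using s y by (simp add: w_eq scalar_prod_add_distrib[of _ n] b_def S_def power2_eq_square)
  have W: "W = t * (t * S + \<nu> * b\<^sup>2) + \<nu> * b * (t * b + \<nu> * b * Y)"
  proof -
    have "W = t * (s \<bullet> w) + \<nu> * b * (w \<bullet> y)"
      using s y w unfolding W_def
      by (subst (2) w_eq) (simp add: scalar_prod_add_distrib[of _ n] comm_scalar_prod[of w n s])
    then show ?thesis by (simp add: sw wy)
  qed
  have norm_sq: "(euclid_norm v)\<^sup>2 = v \<bullet> v" for v
    by (simp add: euclid_norm_def scalar_prod_def sum_nonneg)
  have norm_nonneg: "euclid_norm v \<ge> 0" for v
    by (simp add: euclid_norm_def scalar_prod_def sum_nonneg)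
  \<comment> \<open>Polarization: the squares of \<open>p\<close> and \<open>m\<close> differ by
    \<open>4 * (w \<bullet> y)\<close> and sum to \<open>2 * (W + Y)\<close>, which yields the
    product and the sum of squares of the claimed values.\<close>
  define p m where "p = euclid_norm (w + y)" and "m = euclid_norm (w - y)"
  have p: "p\<^sup>2 = W + 2 * (w \<bullet> y) + Y" and m: "m\<^sup>2 = W - 2 * (w \<bullet> y) + Y"
    using w y unfolding p_def m_def norm_sq
    by (simp_all add: add_scalar_prod_distrib[of _ n] scalar_prod_add_distrib[of _ n]
      minus_scalar_prod_distrib[of _ n] scalar_prod_minus_distrib[of _ n]
      comm_scalar_prod[of y n w] W_def Y_def)
  have sm: "\<sigma>\<^sub>m = euclid_norm s / (2 * b) * (p - m)" and sp: "\<sigma>\<^sub>p = euclid_norm s / (2 * b) * (p + m)"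
    by (simp_all add: assms(9,10) p_def m_def w_def b_def)
  have "\<sigma>\<^sub>m * \<sigma>\<^sub>p = (euclid_norm s)\<^sup>2 * (p\<^sup>2 - m\<^sup>2) / (4 * b\<^sup>2)"
    by (simp add: sm sp power2_eq_square field_simps)
  also have "\<dots> = S * (w \<bullet> y) / b\<^sup>2"
    unfolding p m norm_sq by (simp add: S_def)
  finally have prod: "\<sigma>\<^sub>m * \<sigma>\<^sub>p = S * (w \<bullet> y) / b\<^sup>2" .
  have "\<sigma>\<^sub>m\<^sup>2 + \<sigma>\<^sub>p\<^sup>2 = (euclid_norm s)\<^sup>2 * (p\<^sup>2 + m\<^sup>2) / (2 * b\<^sup>2)"
    using b by (simp add: sm sp power2_eq_square field_simps)
  also have "\<dots> = S * (W + Y) / b\<^sup>2"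
    unfolding p m norm_sq S_def[symmetric] using b by (simp add: field_simps)
  finally have sum: "\<sigma>\<^sub>m\<^sup>2 + \<sigma>\<^sub>p\<^sup>2 = S * (W + Y) / b\<^sup>2" .

  have Y0: "Y \<ge> 0" by (simp add: Y_def scalar_prod_def sum_nonneg)
  \<comment> \<open>The signs of \<open>t\<close> and \<open>\<nu>\<close> enter here: they give
    \<open>m \<le> p\<close>, so that \<open>\<sigma>\<^sub>m\<close> is nonnegative and equals the
    root of its square.\<close>
  have "w \<bullet> y \<ge> 0" unfolding wy using b Y0 assms(5,6) by simp
  then have "m\<^sup>2 \<le> p\<^sup>2" by (simp add: p m)
  then have mp: "m \<le> p" by (rule power2_le_imp_le) (simp add: p_def norm_nonneg)
  have nonneg: "\<sigma>\<^sub>m \<ge> 0" "\<sigma>\<^sub>p \<ge> 0"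
    using mp b norm_nonneg by (simp_all add: sm sp p_def m_def)

  have VU: "(V * U) $$ (0, 0) = k11 * S + k12 * b" "(V * U) $$ (0, 1) = k11 * b + k12 * Y"
    "(V * U) $$ (1, 0) = k12 * S + k22 * b" "(V * U) $$ (1, 1) = k12 * b + k22 * Y"
    using s y by (simp_all add: U_def V_def add_scalar_prod_distrib[of _ n] ys
      S_def Y_def b_def[symmetric])
  \<comment> \<open>The entries of \<open>I + V U\<close>, put over the common denominator
    \<open>b\<^sup>2\<close> so that the determinant becomes a polynomial identity in the
    numerators.\<close>
  have e: "k11 * S + k12 * b + 1 = (t * S * b + W * S) / b\<^sup>2"
    "k12 * b + k22 * Y + 1 = (S * Y - t * S * b) / b\<^sup>2"
    "k12 * S + k22 * b = - t * S\<^sup>2 / b\<^sup>2"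
    "k11 * b + k12 * Y = (2 * t * b\<^sup>2 + W * b - Y * b - t * S * Y) / b\<^sup>2"
    using b by (simp_all add: k11_def k12_def k22_def field_simps power2_eq_square)
  have tr: "(k11 * S + k12 * b + 1) + (k12 * b + k22 * Y + 1) = \<sigma>\<^sub>m\<^sup>2 + \<sigma>\<^sub>p\<^sup>2"
    unfolding e sum by (simp add: add_divide_distrib[symmetric] algebra_simps)
  \<comment> \<open>The left side equals \<open>S\<^sup>2 * (t\<^sup>2 * b\<^sup>2 + W * Y -
    t\<^sup>2 * S * Y)\<close>; inserting the formula for \<open>W\<close> completes the
    square.\<close>
  have num: "(t * S * b + W * S) * (S * Y - t * S * b)
      - (2 * t * b\<^sup>2 + W * b - Y * b - t * S * Y) * (- t * S\<^sup>2)
      = (S * (t * b + \<nu> * b * Y))\<^sup>2"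
    by (simp add: W algebra_simps power2_eq_square)
  have dt: "(k11 * S + k12 * b + 1) * (k12 * b + k22 * Y + 1)
      - (k11 * b + k12 * Y) * (k12 * S + k22 * b) = \<sigma>\<^sub>m\<^sup>2 * \<sigma>\<^sub>p\<^sup>2"
    unfolding e power_mult_distrib[symmetric] prod wy
    by (simp only: times_divide_times_eq diff_divide_distrib[symmetric] num power_divide
      power2_eq_square[of "b\<^sup>2"])
  have "char_poly (1\<^sub>m 2 + V * U) = [:\<sigma>\<^sub>m\<^sup>2 * \<sigma>\<^sub>p\<^sup>2, - (\<sigma>\<^sub>m\<^sup>2 + \<sigma>\<^sub>p\<^sup>2), 1:]"
    unfolding tr[symmetric] dt[symmetric]
    using UV by (subst char_poly_mat_2) (auto simp: VU[unfolded One_nat_def] algebra_simps)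
  also have "\<dots> = [:- \<sigma>\<^sub>m\<^sup>2, 1:] * [:- \<sigma>\<^sub>p\<^sup>2, 1:]"
    by simp
  finally have "[:-1, 1:] ^ 2 * char_poly (transpose_mat P * P)
      = [:-1, 1:] ^ n * ([:- \<sigma>\<^sub>m\<^sup>2, 1:] * [:- \<sigma>\<^sub>p\<^sup>2, 1:])"
    using char_poly_one_add_mult[OF UV] by (simp only: PP)
  \<comment> \<open>With \<open>n \<ge> 2\<close> a factor \<open>(X - 1)^2\<close> splits off and
    can be cancelled, as real polynomials have no zero divisors.\<close>
  also have "[:-1, 1 :: real:] ^ n = [:-1, 1:] ^ 2 * [:-1, 1:] ^ (n - 2)"
    using assms(1) by (metis le_add_diff_inverse power_add)
  finally have "char_poly (transpose_mat P * P)
      = [:-1, 1:] ^ (n - 2) * ([:- \<sigma>\<^sub>m\<^sup>2, 1:] * [:- \<sigma>\<^sub>p\<^sup>2, 1:])"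
    by (simp only: mult.assoc mult_cancel_left) simp
  \<comment> \<open>Multiplying out is switched off so that the roots are read from the linear
    factors.\<close>
  then have "proots (char_poly (transpose_mat P * P))
      = replicate_mset (n - 2) 1 + {#\<sigma>\<^sub>m\<^sup>2, \<sigma>\<^sub>p\<^sup>2#}"
    by (simp add: proots_mult proots_power del: mult_pCons_left mult_pCons_right)
  then have "singular_values P = replicate_mset (n - 2) 1 + {#\<sigma>\<^sub>m, \<sigma>\<^sub>p#}"
    using nonneg by (simp add: singular_values_def)
  \<comment> \<open>This is the symmetry of \<open>T\<close>, checked by evaluating both sides to
    \<open>t * b + \<nu> * b * Y\<close>.\<close>
  moreover have "s \<bullet> (T *\<^sub>v y) = w \<bullet> y"
    using s y by (simp add: assms(7) MDL_scaling_matrix_mult_vec wy scalar_prod_add_distrib[of _ n]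
      b_def Y_def)
  ultimately show ?thesis
    using prod sum unfolding norm_sq
    by (simp add: S_def W_def Y_def w_def b_def power2_eq_square algebra_simps add_divide_distrib)
qed

end
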